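(* Let $(\mathcal{U},\tau_{\mathcal{R}}(\mathcal{M}))$ and $(\mathcal{V},\sigma_{\mathcal{R}}(\mathcal{N}))$ be nano topological spaces. If a map $h:\mathcal{U}\to\mathcal{V}$ is N$\alpha^{*}$-continuous, N-open and bijective, then $h$ is NS$\alpha^{*}$-continuous.
   Context: Nano topological space: let $\mathcal{U}$ be a non-empty finite set (the universe), $\mathcal{R}$ an equivalence relation on $\mathcal{U}$ and $\mathcal{M}\subseteq\mathcal{U}$. The lower approximation $L$ of $\mathcal{M}$ is the union of the $\mathcal{R}$-classes contained in $\mathcal{M}$, the upper approximation $H$ is the union of the $\mathcal{R}$-classes meeting $\mathcal{M}$, and $B=H\setminus L$ is the boundary. Then $\tau_{\mathcal{R}}(\mathcal{M})=\{\emptyset,\mathcal{U},L,H,B\}$ is a topology on $\mathcal{U}$, and $(\mathcal{U},\tau_{\mathcal{R}}(\mathcal{M}))$ is called a nano topological space. Each space has its own equivalence relation; the symbol $\mathcal{R}$ is used for all of them. Members of $\tau_{\mathcal{R}}(\mathcal{M})$ are called N-open and their complements N-closed; $\mathrm{Nint}$ and $\mathrm{Ncl}$ denote interior and closure in this topology. A subset $\mathcal{D}\subseteq\mathcal{U}$ is N$\alpha$-open if $\mathcal{D}\subseteq\mathrm{Nint}(\mathrm{Ncl}(\mathrm{Nint}(\mathcal{D})))$. It is NS$\alpha$-open if there is an N$\alpha$-open set $\mathcal{P}$ with $\mathcal{P}\subseteq\mathcal{D}\subseteq\mathrm{Ncl}(\mathcal{P})$; equivalently, $\mathcal{D}\subseteq\mathrm{Ncl}(\mathrm{Nint}(\mathrm{Ncl}(\mathrm{Nint}(\mathcal{D}))))$.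 A map $h:\mathcal{U}\to\mathcal{V}$ is: N-open if the image of every N-open set in $\mathcal{U}$ is N-open in $\mathcal{V}$; N$\alpha^{*}$-continuous if the preimage of every N$\alpha$-open set in $\mathcal{V}$ is N$\alpha$-open in $\mathcal{U}$; NS$\alpha^{*}$-continuous if the preimage of every NS$\alpha$-open set in $\mathcal{V}$ is NS$\alpha$-open in $\mathcal{U}$. *)

theory Defs
  imports "HOL-Analysis.Abstract_Topology"
begin

definition lower_approx :: "'a set \<Rightarrow> ('a \<times> 'a) set \<Rightarrow> 'a set \<Rightarrow> 'a set" where
  "lower_approx U R M = \<Union>{C \<in> U // R. C \<subseteq> M}"

definition upper_approx :: "'a set \<Rightarrow> ('a \<times> 'a) set \<Rightarrow> 'a set \<Rightarrow> 'a set" where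
  "upper_approx U R M = \<Union>{C \<in> U // R. C \<inter> M \<noteq> {}}"

definition boundary_region :: "'a set \<Rightarrow> ('a \<times> 'a) set \<Rightarrow> 'a set \<Rightarrow> 'a set" where
  "boundary_region U R M = upper_approx U R M - lower_approx U R M"

definition nano_opens :: "'a set \<Rightarrow> ('a \<times> 'a) set \<Rightarrow> 'a set \<Rightarrow> 'a set set" where
  "nano_opens U R M =
     {{}, U, lower_approx U R M, upper_approx U R M, boundary_region U R M}"

definition nano_data :: "'a set \<Rightarrow> ('a \<times> 'a) set \<Rightarrow> 'a set \<Rightarrow> bool" where
  "nano_data U R M \<longleftrightarrow> finite U \<and> U \<noteq> {} \<and> equiv U R \<and> M \<subseteq> U"

definition nano_topology :: "'a set \<Rightarrow> ('a \<times> 'a) set \<Rightarrow> 'a set \<Rightarrow> 'a topology" where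
  "nano_topology U R M = topology (\<lambda>S. S \<in> nano_opens U R M)"

text \<open>
  The constructor \<^const>\<open>topology\<close> is only meaningful for families that are topologies;
  the following facts show that this is the case here.
\<close>

lemma upper_approx_subset:
  assumes "nano_data U R M"
  shows "upper_approx U R M \<subseteq> U"
  using assms Union_quotient[of U R] unfolding nano_data_def upper_approx_def by blast

lemma lower_approx_subset_upper_approx:
  assumes "nano_data U R M"
  shows "lower_approx U R M \<subseteq> upper_approx U R M"
proof
  fix x assume "x \<in> lower_approx U R M"
  then obtain C where "C \<in> U // R" "C \<subseteq> M" "x \<in> C"
    unfolding lower_approx_def by blast
  then show "x \<in> upper_approx U R M"
    unfolding upper_approx_def by blast
qed

lemma istopology_nano_opens:
  assumes "nano_data U R M"
  shows "istopology (\<lambda>S. S \<in> nano_opens U R M)"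
proof -
  define L H B where "L = lower_approx U R M" and "H = upper_approx U R M" and "B = H - L"
  have sub: "L \<subseteq> H" "H \<subseteq> U"
    using lower_approx_subset_upper_approx[OF assms] upper_approx_subset[OF assms]
    by (auto simp: L_def H_def)
  have opens: "nano_opens U R M = {{}, U, L, H, B}"
    by (simp add: nano_opens_def boundary_region_def L_def H_def B_def)
  have inter: "S \<inter> T \<in> {{}, U, L, H, B}"
    if "S \<in> {{}, U, L, H, B}" "T \<in> {{}, U, L, H, B}" for S T
  proof -
    have "U \<inter> L = L" "L \<inter> U = L" "U \<inter> H = H" "H \<inter> U = H" "U \<inter> B = B" "B \<inter> U = B"
      "L \<inter> H = L" "H \<inter> L = L" "L \<inter> B = {}" "B \<inter> L = {}" "H \<inter> B = B" "B \<inter> H = B"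
      using sub by (auto simp: B_def)
    then show ?thesis using that by auto
  qed
  have union2: "S \<union> T \<in> {{}, U, L, H, B}"
    if "S \<in> {{}, U, L, H, B}" "T \<in> {{}, U, L, H, B}" for S T
  proof -
    have "U \<union> L = U" "L \<union> U = U" "U \<union> H = U" "H \<union> U = U" "U \<union> B = U" "B \<union> U = U"
      "L \<union> H = H" "H \<union> L = H" "L \<union> B = H" "B \<union> L = H" "H \<union> B = H" "B \<union> H = H"
      using sub by (auto simp: B_def)
    then show ?thesis using that by auto
  qed
  have "\<Union>K \<in> {{}, U, L, H, B}" if "K \<subseteq> {{}, U, L, H, B}" for K
  proof -
    have "finite K" using that by (rule finite_subset) simp
    then show ?thesis using that
    proof (induction K)
      case empty then show ?case by simp
    next
      case (insert S K)
      then show ?case using union2[of S "\<Union>K"] by simp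
    qed
  qed
  then show ?thesis
    unfolding istopology_def opens using inter by (metis subsetI)
qed

lemma openin_nano_topology:
  assumes "nano_data U R M"
  shows "openin (nano_topology U R M) S \<longleftrightarrow> S \<in> nano_opens U R M"
  using istopology_nano_opens[OF assms]
  by (simp add: nano_topology_def topology_inverse')

lemma topspace_nano_topology:
  assumes "nano_data U R M"
  shows "topspace (nano_topology U R M) = U"
proof
  show "U \<subseteq> topspace (nano_topology U R M)"
    using openin_nano_topology[OF assms, of U] openin_subset by (auto simp: nano_opens_def)
  have "topspace (nano_topology U R M) \<in> nano_opens U R M"
    using openin_nano_topology[OF assms] openin_topspace by blast
  then show "topspace (nano_topology U R M) \<subseteq> U"
    using upper_approx_subset[OF assms] lower_approx_subset_upper_approx[OF assms]
    by (auto simp: nano_opens_def boundary_region_def)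
qed

definition alpha_open :: "'a topology \<Rightarrow> 'a set \<Rightarrow> bool" where
  "alpha_open X D \<longleftrightarrow>
     D \<subseteq> topspace X \<and> D \<subseteq> X interior_of (X closure_of (X interior_of D))"

definition semi_alpha_open :: "'a topology \<Rightarrow> 'a set \<Rightarrow> bool" where
  "semi_alpha_open X D \<longleftrightarrow>
     D \<subseteq> topspace X \<and> (\<exists>P. alpha_open X P \<and> P \<subseteq> D \<and> D \<subseteq> X closure_of P)"

definition alpha_star_continuous :: "'a topology \<Rightarrow> 'b topology \<Rightarrow> ('a \<Rightarrow> 'b) \<Rightarrow> bool" where
  "alpha_star_continuous X Y h \<longleftrightarrow>
     h \<in> topspace X \<rightarrow> topspace Y \<and>
     (\<forall>D. alpha_open Y D \<longrightarrow> alpha_open X {x \<in> topspace X. h x \<in> D})"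

definition semi_alpha_star_continuous :: "'a topology \<Rightarrow> 'b topology \<Rightarrow> ('a \<Rightarrow> 'b) \<Rightarrow> bool" where
  "semi_alpha_star_continuous X Y h \<longleftrightarrow>
     h \<in> topspace X \<rightarrow> topspace Y \<and>
     (\<forall>D. semi_alpha_open Y D \<longrightarrow> semi_alpha_open X {x \<in> topspace X. h x \<in> D})"

end

theory Submission imports Defs begin

text \<open>A semi-\<alpha>-open set \<open>D\<close> is trapped between an \<alpha>-open
  \<open>P\<close> and the closure of \<open>P\<close>, and this sandwich pulls back along
  \<open>h\<close>: the preimage of \<open>P\<close> is \<alpha>-open by \<alpha>*-continuity, and
  it is dense enough in the preimage of \<open>D\<close> because, for an open map, the preimage of a
  closure lies in the closure of the preimage
  (\<open>open_map_preimage_closure_of_subset\<close>).\<close>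

lemma open_map_preimage_closure_of_subset:
  assumes "open_map X Y h"
  shows "{x \<in> topspace X. h x \<in> Y closure_of P} \<subseteq> X closure_of {x \<in> topspace X. h x \<in> P}"
proof
  fix x assume x: "x \<in> {x \<in> topspace X. h x \<in> Y closure_of P}"
  have "\<exists>y. y \<in> {x \<in> topspace X. h x \<in> P} \<and> y \<in> T" if "x \<in> T" "openin X T" for T
  proof -
    \<comment> \<open>The image of \<open>T\<close> is an open neighbourhood of \<open>h x\<close>,
      hence meets \<open>P\<close>; a point of \<open>T\<close> over such a common point is the one
      sought.\<close>
    have "openin Y (h ` T)" using assms that by (simp add: open_map_def)
    with x that obtain z where "z \<in> P" "z \<in> h ` T"
      unfolding in_closure_of by blast
    then show ?thesis using openin_subset[OF \<open>openin X T\<close>] by blast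
  qed
  with x show "x \<in> X closure_of {x \<in> topspace X. h x \<in> P}"
    by (simp add: in_closure_of)
qed

lemma alpha_star_continuous_open_map_imp_semi_alpha_star_continuous:
  assumes cont: "alpha_star_continuous X Y h" and "open_map X Y h"
  shows "semi_alpha_star_continuous X Y h"
  unfolding semi_alpha_star_continuous_def
proof (intro conjI allI impI)
  show "h \<in> topspace X \<rightarrow> topspace Y"
    using cont by (simp add: alpha_star_continuous_def)
next
  fix D assume "semi_alpha_open Y D"
  then obtain P where P: "alpha_open Y P" "P \<subseteq> D" "D \<subseteq> Y closure_of P"
    by (auto simp: semi_alpha_open_def)
  let ?P = "{x \<in> topspace X. h x \<in> P}"
  have "alpha_open X ?P"
    using cont P(1) by (simp add: alpha_star_continuous_def)
  moreover have "?P \<subseteq> {x \<in> topspace X. h x \<in> D}"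
    using P(2) by blast
  \<comment> \<open>Openness of \<open>h\<close> enters here: the preimage of \<open>D\<close> lies
    in that of \<open>Y closure_of P\<close>, which the closure of \<open>?P\<close>
    absorbs.\<close>
  moreover have "{x \<in> topspace X. h x \<in> D} \<subseteq> X closure_of ?P"
    using open_map_preimage_closure_of_subset[OF assms(2), of P] P(3) by blast
  ultimately show "semi_alpha_open X {x \<in> topspace X. h x \<in> D}"
    unfolding semi_alpha_open_def by blast
qed

theorem theorem3p20:
  fixes U M :: "'a set" and R :: "('a \<times> 'a) set"
    and V N :: "'b set" and S :: "('b \<times> 'b) set"
    and h :: "'a \<Rightarrow> 'b"
  assumes "nano_data U R M" and "nano_data V S N"
    and "h \<in> U \<rightarrow> V"
    and "alpha_star_continuous (nano_topology U R M) (nano_topology V S N) h"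
    and "open_map (nano_topology U R M) (nano_topology V S N) h"
    and "bij_betw h U V"
  shows "semi_alpha_star_continuous (nano_topology U R M) (nano_topology V S N) h"
  using assms(4,5) by (rule alpha_star_continuous_open_map_imp_semi_alpha_star_continuous)

end
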